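(* Let $d\ge1$ and let $f,g:D(d)\to D(d)$ be two continuous self-maps such that $f(F_i(D(d)))\subseteq F_i(D(d))$ and $g(F_i(D(d)))\subseteq F_i(D(d))$ for all $0\le i\le d-2$. Then $f$ and $g$ restrict to maps $f',g':S^1\to S^1$ on the circle $\bigcap_iF_i(D(d))=\{(t,\dots,t):t\in\mathbb R\}\cup\{\infty\}\cong S^1$, and $f$ and $g$ are homotopic via a homotopy that preserves each $F_i(D(d))$ if and only if $f'$ and $g'$ have the same degree.
   Context: $D'(d)=\{(t_0,\dots,t_{d-1})\in\mathbb R^d: t_0\le\dots\le t_{d-1}\}$ and $D(d)$ is its one-point compactification. For $0\le i\le d-2$, $F_i(D'(d))=\{t\in D'(d):t_i=t_{i+1}\}$ and $F_i(D(d))=F_i(D'(d))\cup\{\infty\}$ is its one-point compactification, regarded as a subspace of $D(d)$. (For $d=1$ the intersection over the empty set of faces is $D(1)$ itself.) A homotopy $h:[0,1]\times D(d)\to D(d)$ preserves $F_i(D(d))$ if $h_s(F_i(D(d)))\subseteq F_i(D(d))$ for all $s$. *)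

theory Defs
  imports "HOL-Analysis.Analysis" "HOL-Homology.Homology"
begin

text \<open>Points of \<open>\<real>\<^sup>d\<close> are the elements of \<^term>\<open>topspace (Euclidean_space d)\<close>, that is, functions
  \<open>nat \<Rightarrow> real\<close> vanishing at all indices \<open>\<ge> d\<close>; the coordinates are \<open>t 0, \<dots>, t (d - 1)\<close>.\<close>

definition D' :: "nat \<Rightarrow> (nat \<Rightarrow> real) topology" where
  "D' d = subtopology (Euclidean_space d) {t. \<forall>i. Suc i < d \<longrightarrow> t i \<le> t (Suc i)}"

definition D :: "nat \<Rightarrow> (nat \<Rightarrow> real) option topology" where
  "D d = Alexandroff_compactification (D' d)"

definition F' :: "nat \<Rightarrow> nat \<Rightarrow> (nat \<Rightarrow> real) set" where
  "F' d i = {t \<in> topspace (D' d). t i = t (Suc i)}"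

text \<open>In the Alexandroff compactification the point at infinity is \<^term>\<open>None\<close>.\<close>

definition F :: "nat \<Rightarrow> nat \<Rightarrow> (nat \<Rightarrow> real) option set" where
  "F d i = insert None (Some ` F' d i)"

text \<open>The faces are indexed by \<open>0 \<le> i \<le> d - 2\<close>, written \<open>Suc i < d\<close> to avoid truncated
  subtraction.\<close>

definition preserves_faces ::
    "nat \<Rightarrow> ((nat \<Rightarrow> real) option \<Rightarrow> (nat \<Rightarrow> real) option) \<Rightarrow> bool" where
  "preserves_faces d f \<longleftrightarrow> (\<forall>i. Suc i < d \<longrightarrow> f ` F d i \<subseteq> F d i)"

text \<open>The intersection is taken inside the space, so that it is the whole space when there are no
  faces (\<open>d = 1\<close>).\<close>

definition faces_inter :: "nat \<Rightarrow> (nat \<Rightarrow> real) option set" where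
  "faces_inter d = topspace (D d) \<inter> (\<Inter>i\<in>{i. Suc i < d}. F d i)"

definition diag :: "nat \<Rightarrow> real \<Rightarrow> nat \<Rightarrow> real" where
  "diag d t = (\<lambda>i. if i < d then t else 0)"

text \<open>The degree of a self-map \<open>f\<close> of a space \<open>X\<close> identified with the circle by mutually inverse
  homeomorphisms \<open>\<phi> : X \<rightarrow> S\<^sup>1\<close> and \<open>\<psi> : S\<^sup>1 \<rightarrow> X\<close>. Since the degree is multiplicative under composition,
  the value does not depend on the identification. Only the values of \<open>f\<close> on \<open>X\<close> matter, so this
  also serves as the degree of the restriction to \<open>X\<close> of a map defined on a larger space.\<close>

definition circle_degree :: "('a \<Rightarrow> nat \<Rightarrow> real) \<Rightarrow> ((nat \<Rightarrow> real) \<Rightarrow> 'a) \<Rightarrow> ('a \<Rightarrow> 'a) \<Rightarrow> int" where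
  "circle_degree \<phi> \<psi> f = Brouwer_degree2 1 (\<phi> \<circ> f \<circ> \<psi>)"

end

theory Submission
  imports Defs
begin

text \<open>
  In the coordinates \<open>t 0, t 1 - t 0, \<dots>, t (d - 1) - t (d - 2)\<close> the chamber is
  \<open>\<real> \<times> [0, \<infinity>)\<^sup>d\<^sup>-\<^sup>1\<close>, and inverse stereographic projection identifies its compactification with
  the part \<open>Q\<close> of the \<open>d\<close>-sphere on which the coordinates \<open>v i\<close>, \<open>i \<ge> 2\<close>, are nonnegative. The faces
  become the walls \<open>v i = 0\<close>, and their intersection is the circle in the plane of \<open>v 0\<close> and \<open>v 1\<close>.

  If \<open>f\<close> and \<open>g\<close> have the same degree on the circle, then \<open>f v\<close> is there the rotation of \<open>g v\<close> by
  an angle \<open>h v\<close> with \<open>h\<close> continuous and real-valued. Extend \<open>h\<close> to \<open>Q\<close> by Tietze. Rotating the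
  first two coordinates of \<open>g v\<close> by \<open>s h v\<close> moves \<open>g\<close>, without disturbing the walls, to a map that
  agrees with \<open>f\<close> on the circle. Two such maps \<open>f\<close>, \<open>g\<close> are joined by the normalisation of
  \<open>(1 - s) f v + s g v + s (1 - s) (0, 0, v 2, \<dots>, v d)\<close>, which never vanishes: off the circle
  some coordinate \<open>v i\<close>, \<open>i \<ge> 2\<close>, is positive, and on the circle \<open>f v = g v\<close>.

  The angle \<open>h\<close> exists because the Brouwer degree is a winding number: the total angle swept by a
  singular 1-simplex of the circle extends linearly to chains and kills boundaries, so pushing
  the fundamental loop forward along \<open>f\<close> multiplies its angle \<open>2\<pi>\<close> by the degree of \<open>f\<close>.
\<close>

section \<open>The Brouwer degree of circle maps as a winding number\<close>

definition circ :: "real \<Rightarrow> nat \<Rightarrow> real" where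
  "circ t = (\<lambda>i. if i = 0 then cos t else if i = 1 then sin t else 0)"

definition rot :: "real \<Rightarrow> (nat \<Rightarrow> real) \<Rightarrow> nat \<Rightarrow> real" where
  "rot a x = x(0 := cos a * x 0 - sin a * x 1, 1 := sin a * x 0 + cos a * x 1)"

lemma rot_circ: "rot a (circ b) = circ (a + b)"
  by (auto simp: rot_def circ_def fun_eq_iff cos_add sin_add)

lemma in_nsphere1: "x \<in> topspace (nsphere 1) \<longleftrightarrow> x 0 ^ 2 + x 1 ^ 2 = 1 \<and> (\<forall>i\<ge>2. x i = 0)"
  by (auto simp: nsphere numeral_2_eq_2 Suc_le_eq)

lemma circ_in_nsphere: "circ t \<in> topspace (nsphere 1)"
  unfolding in_nsphere1 by (simp add: circ_def)

lemma circ_eq_iff: "circ a = circ b \<longleftrightarrow> (\<exists>n::int. a = b + 2 * pi * n)"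
proof -
  have "circ a = circ b \<longleftrightarrow> cos a = cos b \<and> sin a = sin b"
    by (auto simp: circ_def fun_eq_iff)
  also have "\<dots> \<longleftrightarrow> (\<exists>n::int. a = b + 2 * pi * n)"
    using sin_cos_eq_iff[of a b] by (auto simp: algebra_simps)
  finally show ?thesis .
qed

lemma continuous_map_circ: "continuous_map euclideanreal (nsphere 1) circ"
proof -
  have "continuous_on UNIV (\<lambda>t. circ t k)" for k
    unfolding circ_def by (cases "k = 0"; cases "k = 1") (auto intro!: continuous_intros)
  then show ?thesis
    using circ_in_nsphere
    by (auto simp: nsphere continuous_map_in_subtopology continuous_map_componentwise_UNIV)
qed

lemma nsphere1_obtain_angle:
  assumes "x \<in> topspace (nsphere 1)"
  obtains t where "0 \<le> t" "t < 2 * pi" "x = circ t"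
proof -
  obtain t where t: "0 \<le> t" "t < 2 * pi" "x 0 = cos t" "x 1 = sin t"
    using assms sincos_total_2pi[of "x 0" "x 1"] unfolding in_nsphere1 by blast
  have "x = circ t"
  proof
    fix i show "x i = circ t i"
      using t assms unfolding in_nsphere1 circ_def
      by (cases "i \<ge> 2") (auto dest!: less_2_cases simp: not_le)
  qed
  with t that show ?thesis by blast
qed

text \<open>A convex set is contractible, so the nowhere vanishing complex function with parts
  \<open>c x 0\<close> and \<open>c x 1\<close> has a continuous logarithm on it. Its modulus is
  one, so the imaginary part of the logarithm is an angle.\<close>

lemma lift_to_circ:
  fixes S :: "'a::real_normed_vector set"
  assumes "convex S" and c: "continuous_map (top_of_set S) (nsphere 1) c"
  obtains a :: "'a \<Rightarrow> real" where "continuous_on S a" "\<And>x. x \<in> S \<Longrightarrow> c x = circ (a x)"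
proof -
  have comp: "continuous_on S (\<lambda>x. c x k)" for k
    using continuous_map_compose[OF c continuous_map_nsphere_projection[of 1 k]]
    by (simp add: o_def)
  have cin: "c x \<in> topspace (nsphere 1)" if "x \<in> S" for x
    using that continuous_map_image_subset_topspace[OF c] by auto
  define f where "f = (\<lambda>x. Complex (c x 0) (c x 1))"
  have contf: "continuous_on S f"
    unfolding f_def Complex_eq by (intro continuous_intros comp)
  have norm1: "norm (f x) = 1" if "x \<in> S" for x
    using cin[OF that] unfolding in_nsphere1 f_def by (simp add: cmod_def)
  obtain g where g: "continuous_on S g" "\<And>x. x \<in> S \<Longrightarrow> f x = exp (g x)"
    using continuous_logarithm_on_contractible[OF contf convex_imp_contractible[OF \<open>convex S\<close>]]
    by (metis norm1 norm_zero zero_neq_one)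
  have "c x = circ (Im (g x))" if "x \<in> S" for x
  proof -
    have "exp (Re (g x)) = 1"
      using norm1[OF that] g(2)[OF that] by (simp add: norm_exp_eq_Re)
    then have *: "f x = cis (Im (g x))"
      using g(2)[OF that] by (simp add: exp_eq_polar)
    have "c x i = circ (Im (g x)) i" for i
      using * cin[OF that] unfolding f_def in_nsphere1 circ_def
      by (cases "i \<ge> 2") (auto simp: complex_eq_iff less_2_cases_iff not_le)
    then show ?thesis ..
  qed
  moreover have "continuous_on S (\<lambda>x. Im (g x))"
    by (intro continuous_intros g)
  ultimately show ?thesis using that by blast
qed

text \<open>Two lifts differ by \<open>2 * pi\<close> times a continuous integer-valued function,
  which is constant on the interval.\<close>

lemma lift_increment_unique:
  fixes a b :: "real \<Rightarrow> real"
  assumes "continuous_on {0..1} a" "continuous_on {0..1} b"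
    and eq: "\<And>t. t \<in> {0..1} \<Longrightarrow> circ (a t) = circ (b t)"
  shows "a 1 - a 0 = b 1 - b 0"
proof -
  define m where "m = (\<lambda>t. (a t - b t) / (2 * pi))"
  have mZ: "m t \<in> \<int>" if "t \<in> {0..1}" for t
    using eq[OF that] unfolding circ_eq_iff m_def by (auto simp: field_simps)
  have "m constant_on {0..1}"
  proof (rule continuous_discrete_range_constant)
    show "continuous_on {0..1} m"
      unfolding m_def by (intro continuous_intros assms) auto
    fix x :: real
    assume x: "x \<in> {0..1}"
    show "\<exists>e>0. \<forall>y. y \<in> {0..1} \<and> m y \<noteq> m x \<longrightarrow> e \<le> norm (m y - m x)"
    proof (intro exI[of _ 1] conjI allI impI)
      fix y
      assume "y \<in> {0..1} \<and> m y \<noteq> m x"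
      then have "m y - m x \<in> \<int>" "m y - m x \<noteq> 0"
        using mZ x by auto
      then show "1 \<le> norm (m y - m x)"
        by (metis Ints_nonzero_abs_ge1 real_norm_def)
    qed simp
  qed auto
  then have "m 1 = m 0"
    unfolding constant_on_def by force
  then show ?thesis by (simp add: m_def field_simps)
qed

section \<open>Angle swept by a singular 1-simplex\<close>

definition seg :: "real \<Rightarrow> nat \<Rightarrow> real" where
  "seg t = (\<lambda>i. if i = 0 then 1 - t else if i = 1 then t else 0)"

lemma seg_in_simplex: "t \<in> {0..1} \<Longrightarrow> seg t \<in> standard_simplex 1"
  by (auto simp: seg_def standard_simplex_def)

text \<open>The total angle swept along \<^term>\<open>\<sigma>\<close>; it is unspecified unless \<^term>\<open>\<sigma>\<close> is a 1-simplex of the circle.\<close>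

definition winding :: "((nat \<Rightarrow> real) \<Rightarrow> nat \<Rightarrow> real) \<Rightarrow> real" where
  "winding \<sigma> = (SOME r. \<exists>a. continuous_on {0..1} a \<and>
     (\<forall>t\<in>{0..1}. \<sigma> (seg t) = circ (a t)) \<and> r = a 1 - a 0)"

text \<open>The choice made in \<open>winding\<close> is harmless, since all lifts have the same
  increment; any convenient lift computes it.\<close>

lemma winding_eq:
  assumes "continuous_on {0..1} a" "\<And>t. t \<in> {0..1} \<Longrightarrow> \<sigma> (seg t) = circ (a t)"
  shows "winding \<sigma> = a 1 - a 0"
  unfolding winding_def
proof (rule some_equality)
  show "\<exists>b. continuous_on {0..1} b \<and> (\<forall>t\<in>{0..1}. \<sigma> (seg t) = circ (b t)) \<and> a 1 - a 0 = b 1 - b 0"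
    using assms by auto
qed (use assms lift_increment_unique in \<open>metis (full_types)\<close>)

text \<open>The simplex is convex, so \<tau> has a single angle function on it. Each face
  contributes the difference of its values at two vertices, and the alternating sum cancels.\<close>

lemma winding_boundary:
  assumes "singular_simplex 2 (nsphere 1) \<tau>"
  shows "winding (singular_face 2 0 \<tau>) - winding (singular_face 2 1 \<tau>) + winding (singular_face 2 2 \<tau>) = 0"
proof -
  \<comment> \<open>\<open>T\<close> is the 2-simplex drawn in the plane, a normed space as
    \<open>lift_to_circ\<close> requires, and \<open>e\<close> returns barycentric coordinates; (0,
    0), (1, 0), (0, 1) are the vertices 0, 1, 2.\<close>
  define T where "T = {z::real\<times>real. 0 \<le> fst z \<and> 0 \<le> snd z \<and> fst z + snd z \<le> 1}"
  define e where "e = (\<lambda>z::real\<times>real. \<lambda>i::nat. if i = 0 then 1 - fst z - snd z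
    else if i = 1 then fst z else if i = 2 then snd z else 0)"
  have "convex T"
  proof (rule convexI)
    fix x y :: "real \<times> real" and u v :: real
    assume *: "x \<in> T" "y \<in> T" "0 \<le> u" "0 \<le> v" "u + v = 1"
    then have "u * (fst x + snd x) + v * (fst y + snd y) \<le> 1"
      by (intro convex_bound_le) (auto simp: T_def)
    with * show "u *\<^sub>R x + v *\<^sub>R y \<in> T"
      by (simp add: T_def algebra_simps)
  qed
  have "continuous_on T (\<lambda>t. e t k)" for k
    unfolding e_def by (cases "k = 0"; cases "k = 1"; cases "k = 2") (auto intro!: continuous_intros)
  moreover have "e z \<in> standard_simplex 2" if "z \<in> T" for z
    using that by (auto simp: e_def T_def standard_simplex_def numeral_2_eq_2)
  ultimately have "continuous_map (top_of_set T) (subtopology (powertop_real UNIV) (standard_simplex 2)) e"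
    by (auto simp: continuous_map_in_subtopology continuous_map_componentwise_UNIV)
  then have "continuous_map (top_of_set T) (nsphere 1) (\<tau> \<circ> e)"
    using assms unfolding singular_simplex_def by (blast intro: continuous_map_compose)
  then obtain G where G: "continuous_on T G" "\<And>z. z \<in> T \<Longrightarrow> (\<tau> \<circ> e) z = circ (G z)"
    using lift_to_circ[OF \<open>convex T\<close>] by blast
  have face: "winding (singular_face 2 k \<tau>) = G (p 1) - G (p 0)"
    if p: "continuous_on {0..1} p" "\<And>t. t \<in> {0..1} \<Longrightarrow> p t \<in> T"
      and eq: "\<And>t. simplical_face k (seg t) = e (p t)" for k p
  proof (rule winding_eq)
    show "continuous_on {0..1} (\<lambda>t. G (p t))"
      by (rule continuous_on_compose2[OF G(1) p(1)]) (use p in auto)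
    show "singular_face 2 k \<tau> (seg t) = circ (G (p t))" if "t \<in> {0..1}" for t
      using G(2)[OF p(2)[OF that]] seg_in_simplex[OF that] by (simp add: singular_face_def eq)
  qed
  \<comment> \<open>The edge opposite vertex 0 is \<open>t \<mapsto> (1 - t, t)\<close>; the
    unevaluated \<open>1-1\<close> and \<open>1-0\<close> let unification find this path.\<close>
  have "winding (singular_face 2 0 \<tau>) = G (1-1, 1) - G (1-0, 0)"
    by (rule face) (auto simp: T_def simplical_face_def seg_def e_def fun_eq_iff intro!: continuous_intros)
  moreover have "winding (singular_face 2 1 \<tau>) = G (0, 1) - G (0, 0)"
    by (rule face) (auto simp: T_def simplical_face_def seg_def e_def fun_eq_iff intro!: continuous_intros)
  moreover have "winding (singular_face 2 2 \<tau>) = G (1, 0) - G (0, 0)"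
    by (rule face) (auto simp: T_def simplical_face_def seg_def e_def fun_eq_iff intro!: continuous_intros)
  ultimately show ?thesis by simp
qed

section \<open>Linear extension of the swept angle to chains and homology classes\<close>

definition chain_winding :: "(nat \<Rightarrow> real) chain \<Rightarrow> real" where
  "chain_winding c = (\<Sum>\<sigma>\<in>Poly_Mapping.keys c. of_int (Poly_Mapping.lookup c \<sigma>) * winding \<sigma>)"

text \<open>A common larger support lets two chains be compared term by term.\<close>

lemma chain_winding_superset:
  assumes "finite K" "Poly_Mapping.keys c \<subseteq> K"
  shows "chain_winding c = (\<Sum>\<sigma>\<in>K. of_int (Poly_Mapping.lookup c \<sigma>) * winding \<sigma>)"
  unfolding chain_winding_def
  by (rule sum.mono_neutral_left) (use assms in \<open>auto simp: in_keys_iff\<close>)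

lemma chain_winding_add: "chain_winding (a + b) = chain_winding a + chain_winding b"
proof -
  let ?K = "Poly_Mapping.keys a \<union> Poly_Mapping.keys b"
  have "Poly_Mapping.keys (a + b) \<subseteq> ?K"
    by (rule keys_add)
  then show ?thesis
    by (simp add: chain_winding_superset[of ?K] lookup_add sum.distrib algebra_simps)
qed

lemma chain_winding_0 [simp]: "chain_winding 0 = 0"
  by (simp add: chain_winding_def)

lemma chain_winding_minus: "chain_winding (- a) = - chain_winding a"
  using chain_winding_add[of a "- a"] by simp

lemma chain_winding_diff: "chain_winding (a - b) = chain_winding a - chain_winding b"
  using chain_winding_add[of a "- b"] by (simp add: chain_winding_minus)

lemma chain_winding_of [simp]: "chain_winding (frag_of \<sigma>) = winding \<sigma>"
  by (simp add: chain_winding_def)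

lemma chain_winding_boundary:
  assumes "singular_chain 2 (nsphere 1) c"
  shows "chain_winding (chain_boundary 2 c) = 0"
  using assms unfolding singular_chain_def
proof (induction rule: frag_induction)
  case (one \<tau>)
  then have "winding (singular_face 2 0 \<tau>) - winding (singular_face 2 1 \<tau>) + winding (singular_face 2 2 \<tau>) = 0"
    using winding_boundary by simp
  then show ?case
    by (simp add: chain_boundary_of numeral_2_eq_2 chain_winding_add chain_winding_minus chain_winding_diff)
qed (auto simp: chain_boundary_diff chain_winding_diff)

lemma chain_winding_relboundary:
  "singular_relboundary 1 (nsphere 1) {} c \<Longrightarrow> chain_winding c = 0"
  unfolding singular_boundary using chain_winding_boundary by (auto simp: numeral_2_eq_2)

text \<open>\<open>chain_winding\<close> is additive and vanishes on boundaries, hence descends to a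
  homomorphism from the first homology group to the reals; here this is phrased through
  representatives.\<close>

lemma chain_winding_int_pow:
  fixes k :: int
  assumes x: "x \<in> carrier (homology_group 1 (nsphere 1))"
    and "c \<in> x [^]\<^bsub>homology_group 1 (nsphere 1)\<^esub> k" "b \<in> x"
  shows "chain_winding c = of_int k * chain_winding b"
proof -
  let ?G = "homology_group (int 1) (nsphere 1)"
  interpret G: group ?G
    by simp
  have x: "x \<in> carrier ?G"
    using x by simp
  then obtain c0 where c0: "x = homologous_rel_set 1 (nsphere 1) {} c0"
    unfolding carrier_relative_homology_group by auto
  have W: "chain_winding u = chain_winding c0" if "u \<in> x" for u
    using that chain_winding_relboundary[of "c0 - u"]
    unfolding c0 homologous_rel_def by (simp add: chain_winding_diff)
  have "\<forall>c \<in> x [^]\<^bsub>?G\<^esub> k. chain_winding c = of_int k * chain_winding b"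
  proof (induction k rule: int_induct[where k = 0])
    case base
    show ?case
      using chain_winding_relboundary by (simp only: int_pow_0 one_relative_homology_group) simp
  next
    case (step1 i)
    have "x [^]\<^bsub>?G\<^esub> (i + 1) = x [^]\<^bsub>?G\<^esub> i \<otimes>\<^bsub>?G\<^esub> x"
      using G.int_pow_mult[OF x, of i 1] G.int_pow_1[OF x] by simp
    then show ?case
      using step1.IH W \<open>b \<in> x\<close>
      unfolding mult_relative_homology_group by (auto simp: chain_winding_add algebra_simps)
  next
    case (step2 i)
    have "x [^]\<^bsub>?G\<^esub> i = x [^]\<^bsub>?G\<^esub> (i - 1) \<otimes>\<^bsub>?G\<^esub> x"
      using G.int_pow_mult[OF x, of "i - 1" 1] G.int_pow_1[OF x] by simp
    \<comment> \<open>Going down, the known power is \<open>i\<close>: adding \<open>b\<close> to a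
      representative of the power \<open>i - 1\<close> gives one of it, and the value for
      \<open>i - 1\<close> follows by subtraction.\<close>
    then have "c + b \<in> x [^]\<^bsub>?G\<^esub> i" if "c \<in> x [^]\<^bsub>?G\<^esub> (i - 1)" for c
      using that \<open>b \<in> x\<close> unfolding mult_relative_homology_group by auto
    then show ?case
      using step2.IH by (fastforce simp: chain_winding_add algebra_simps)
  qed
  with assms show ?thesis by simp
qed

section \<open>The fundamental loop and its image under a circle map\<close>

definition loop :: "(nat \<Rightarrow> real) \<Rightarrow> nat \<Rightarrow> real" where
  "loop = restrict (\<lambda>u. circ (2 * pi * u 1)) (standard_simplex 1)"

lemma loop_seg: "t \<in> {0..1} \<Longrightarrow> loop (seg t) = circ (2 * pi * t)"
  using seg_in_simplex[of t] by (simp add: loop_def) (simp add: seg_def)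

lemma singular_simplex_loop: "singular_simplex 1 (nsphere 1) loop"
proof -
  have "continuous_map (powertop_real UNIV) euclideanreal (\<lambda>u::nat\<Rightarrow>real. u 1)"
    by (rule continuous_map_product_projection) simp
  then have "continuous_map (powertop_real UNIV) euclideanreal (\<lambda>u::nat\<Rightarrow>real. 2 * pi * u 1)"
    by (rule continuous_map_real_mult_left)
  then have "continuous_map (powertop_real UNIV) (nsphere 1) (circ \<circ> (\<lambda>u::nat\<Rightarrow>real. 2 * pi * u 1))"
    by (rule continuous_map_compose[OF _ continuous_map_circ])
  then have "continuous_map (subtopology (powertop_real UNIV) (standard_simplex 1)) (nsphere 1)
     (circ \<circ> (\<lambda>u::nat\<Rightarrow>real. 2 * pi * u 1))"
    by (rule continuous_map_from_subtopology)
  then have "continuous_map (subtopology (powertop_real UNIV) (standard_simplex 1)) (nsphere 1) loop"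
    by (rule continuous_map_eq) (simp add: loop_def)
  \<comment> \<open>Singular simplices must be extensional, hence the \<open>restrict\<close> in
    \<open>loop\<close>.\<close>
  then show ?thesis
    by (simp add: singular_simplex_def loop_def)
qed

text \<open>The two faces are the endpoints, with angles \<open>2 * pi\<close> and 0, so they are
  the same 0-simplex and cancel in the boundary.\<close>

lemma singular_relcycle_loop: "singular_relcycle 1 (nsphere 1) {} (frag_of loop)"
proof -
  have "singular_face 1 0 loop = singular_face 1 1 loop"
  proof
    fix u
    show "singular_face 1 0 loop u = singular_face 1 1 loop u"
    proof (cases "u \<in> standard_simplex 0")
      case True
      then have "loop (simplical_face k u) = circ (2 * pi * simplical_face k u 1)" if "k \<le> 1" for k
        using simplical_face_in_standard_simplex[of 1 k u] that by (simp add: loop_def)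
      moreover have "circ (2 * pi) = circ 0"
        by (auto simp: circ_def)
      moreover have "simplical_face 0 u 1 = 1" "simplical_face 1 u 1 = 0"
        using True by (simp_all add: standard_simplex_0 simplical_face_def)
      ultimately have "loop (simplical_face 0 u) = loop (simplical_face 1 u)"
        by simp
      then show ?thesis
        using True by (simp add: singular_face_def)
    qed (simp add: singular_face_def)
  qed
  then show ?thesis
    using singular_simplex_loop by (simp add: singular_cycle singular_chain_of chain_boundary_of)
qed

text \<open>On first homology \<open>f\<close> acts as the power whose exponent is its degree, and
  the image of the class of \<open>loop\<close> is represented by the pushed-forward loop. Comparing
  the angles of representatives gives the factor.\<close>

lemma winding_simplex_map_loop:
  assumes f: "continuous_map (nsphere 1) (nsphere 1) f"
  shows "winding (simplex_map 1 f loop) = 2 * pi * of_int (Brouwer_degree2 1 f)"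
proof -
  let ?G = "homology_group 1 (nsphere 1)"
  define x where "x = homologous_rel_set 1 (nsphere 1) {} (frag_of loop)"
  have x: "x \<in> carrier ?G"
    using singular_relcycle_loop carrier_relative_homology_group[of 1] by (auto simp: x_def)
  \<comment> \<open>The Brouwer degree is defined by reduced homology, which agrees with ordinary
    homology in dimension 1.\<close>
  have red: "reduced_homology_group 1 (nsphere 1) = ?G"
    by (rule un_reduced_homology_group) simp
  have "hom_induced 1 (nsphere 1) {} (nsphere 1) {} f x = x [^]\<^bsub>?G\<^esub> Brouwer_degree2 1 f"
    using Brouwer_degree2[of x 1 f] x red by simp
  moreover have "hom_induced 1 (nsphere 1) {} (nsphere 1) {} f x =
      homologous_rel_set 1 (nsphere 1) {} (frag_of (simplex_map 1 f loop))"
    using hom_induced_chain_map[OF f _ singular_relcycle_loop, of "{}"] by (simp add: x_def)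
  ultimately have "frag_of (simplex_map 1 f loop) \<in> x [^]\<^bsub>?G\<^esub> Brouwer_degree2 1 f"
    by (metis homologous_rel_refl mem_Collect_eq)
  moreover have "frag_of loop \<in> x"
    by (simp add: x_def)
  moreover have "winding loop = 2 * pi"
    using winding_eq[of "\<lambda>t. 2 * pi * t" loop] by (simp add: loop_seg continuous_intros)
  ultimately show ?thesis
    using chain_winding_int_pow[OF x, of "frag_of (simplex_map 1 f loop)" "Brouwer_degree2 1 f" "frag_of loop"]
    by (simp add: mult.commute)
qed

text \<open>Lift \<open>f\<close> and \<open>g\<close> along the parametrisation of the circle by
  [0, 1]. Equal degrees give the lifts \<open>a\<close> and \<open>b\<close> equal increments, so
  \<open>a - b\<close> agrees at both ends and descends to the circle through the quotient
  map.\<close>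

lemma same_degree_imp_rotation:
  assumes f: "continuous_map (nsphere 1) (nsphere 1) f" and g: "continuous_map (nsphere 1) (nsphere 1) g"
    and deg: "Brouwer_degree2 1 f = Brouwer_degree2 1 g"
  obtains h where "continuous_map (nsphere 1) euclideanreal h"
    "\<And>x. x \<in> topspace (nsphere 1) \<Longrightarrow> f x = rot (h x) (g x)"
proof -
  let ?q = "\<lambda>t. circ (2 * pi * t)"
  have q: "continuous_map (top_of_set {0..1}) (nsphere 1) ?q"
    using continuous_map_compose[OF _ continuous_map_circ, of "top_of_set {0..1}" "\<lambda>t. 2 * pi * t"]
    by (simp add: o_def continuous_intros)
  obtain a where a: "continuous_on {0..1} a" "\<And>t. t \<in> {0..1} \<Longrightarrow> f (?q t) = circ (a t)"
    using lift_to_circ[of "{0..1::real}" "f \<circ> ?q"] continuous_map_compose[OF q f] by auto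
  obtain b where b: "continuous_on {0..1} b" "\<And>t. t \<in> {0..1} \<Longrightarrow> g (?q t) = circ (b t)"
    using lift_to_circ[of "{0..1::real}" "g \<circ> ?q"] continuous_map_compose[OF q g] by auto
  have "winding (simplex_map 1 f loop) = a 1 - a 0"
    by (rule winding_eq) (use a loop_seg seg_in_simplex in \<open>auto simp: simplex_map_def\<close>)
  moreover have "winding (simplex_map 1 g loop) = b 1 - b 0"
    by (rule winding_eq) (use b loop_seg seg_in_simplex in \<open>auto simp: simplex_map_def\<close>)
  ultimately have incr: "a 1 - a 0 = b 1 - b 0"
    using winding_simplex_map_loop[OF f] winding_simplex_map_loop[OF g] deg by simp
  have surj: "\<exists>t\<in>{0..1}. x = ?q t" if x: "x \<in> topspace (nsphere 1)" for x
  proof -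
    obtain t where "0 \<le> t" "t < 2 * pi" "x = circ t"
      using nsphere1_obtain_angle[OF x] by blast
    then show ?thesis
      by (intro bexI[of _ "t / (2 * pi)"]) auto
  qed
  have quot: "quotient_map (top_of_set {0..1}) (nsphere 1) ?q"
  proof (rule T1_Spaces.continuous_imp_quotient_map[OF q])
    show "compact_space (top_of_set {0..1::real})"
      by (simp add: compact_space_subtopology)
    show "Hausdorff_space (nsphere 1)"
      by (simp add: nsphere_def Hausdorff_space_subtopology Hausdorff_Euclidean_space)
    show "?q ` topspace (top_of_set {0..1}) = topspace (nsphere 1)"
      using surj circ_in_nsphere by auto
  qed
  have diff: "continuous_map (top_of_set {0..1}) euclideanreal (\<lambda>t. a t - b t)"
    using a b by (simp add: continuous_intros)
  have periodic: "a s - b s = a t - b t" if st: "s \<in> {0..1}" "t \<in> {0..1}" "?q s = ?q t" for s t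
  proof -
    obtain n :: int where n: "2 * pi * s = 2 * pi * t + 2 * pi * n"
      using st(3) circ_eq_iff by blast
    then have "2 * pi * s = 2 * pi * (t + n)"
      by (simp add: algebra_simps)
    then have "s = t + n"
      by simp
    \<comment> \<open>Two points of [0, 1] at integer distance coincide or are the two ends; at the
      ends \<open>incr\<close> applies.\<close>
    with st have "n = 0 \<or> n = 1 \<and> s = 1 \<and> t = 0 \<or> n = -1 \<and> s = 0 \<and> t = 1"
      by (simp, smt (verit) of_int_1 of_int_le_iff of_int_less_iff of_int_minus of_int_0)
    with \<open>s = t + n\<close> incr show ?thesis by auto
  qed
  have "a s - b s = a t - b t"
    if "s \<in> topspace (top_of_set {0..1})" "t \<in> topspace (top_of_set {0..1})" "?q s = ?q t" for s t
    by (rule periodic) (use that in simp_all)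
  then obtain h where h: "continuous_map (nsphere 1) euclideanreal h"
      "\<And>t. t \<in> topspace (top_of_set {0..1}) \<Longrightarrow> h (?q t) = a t - b t"
    by (rule quotient_map_lift_exists[OF quot diff]) blast+
  have "f x = rot (h x) (g x)" if "x \<in> topspace (nsphere 1)" for x
    using surj[OF that] a(2) b(2) h(2) by (auto simp: rot_circ)
  with h(1) that show ?thesis by blast
qed

section \<open>Homotopies preserving the walls of the orthant of the sphere\<close>

definition orthant_sphere :: "nat \<Rightarrow> (nat \<Rightarrow> real) topology" where
  "orthant_sphere d = subtopology (nsphere d) {v. \<forall>i\<ge>2. 0 \<le> v i}"

text \<open>The quantifier has no upper bound: coordinates above \<open>d\<close> vanish throughout
  the orthant, so every self-map meets the condition there.\<close>

definition keeps_walls :: "nat \<Rightarrow> ((nat \<Rightarrow> real) \<Rightarrow> nat \<Rightarrow> real) \<Rightarrow> bool" where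
  "keeps_walls d f \<longleftrightarrow> (\<forall>i\<ge>2. \<forall>v\<in>topspace (orthant_sphere d). v i = 0 \<longrightarrow> f v i = 0)"

text \<open>As a subspace of the product topology, the orthant allows continuity and closedness to
  be checked coordinate by coordinate.\<close>

lemma orthant_sphere_alt:
  "orthant_sphere d = subtopology (powertop_real UNIV)
     {v. (\<Sum>i\<le>d. v i ^ 2) = 1 \<and> (\<forall>i>d. v i = 0) \<and> (\<forall>i\<ge>2. 0 \<le> v i)}"
  unfolding orthant_sphere_def nsphere subtopology_subtopology
  by (rule arg_cong[where f = "subtopology _"]) auto

lemma in_orthant_sphere:
  "v \<in> topspace (orthant_sphere d) \<longleftrightarrow>
     (\<Sum>i\<le>d. v i ^ 2) = 1 \<and> (\<forall>i>d. v i = 0) \<and> (\<forall>i\<ge>2. 0 \<le> v i)"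
  unfolding orthant_sphere_alt by simp

lemma continuous_map_into_orthant_sphere:
  "continuous_map X (orthant_sphere d) f \<longleftrightarrow>
     (\<forall>k. continuous_map X euclideanreal (\<lambda>x. f x k)) \<and> (\<forall>x\<in>topspace X. f x \<in> topspace (orthant_sphere d))"
  unfolding orthant_sphere_alt continuous_map_in_subtopology continuous_map_componentwise_UNIV
  by auto

lemma continuous_map_orthant_sphere_projection:
  "continuous_map (orthant_sphere d) euclideanreal (\<lambda>v. v k)"
  unfolding orthant_sphere_def by (intro continuous_map_from_subtopology continuous_map_nsphere_projection)

lemma Hausdorff_orthant_sphere: "Hausdorff_space (orthant_sphere d)"
  by (simp add: orthant_sphere_def nsphere_def Hausdorff_space_subtopology Hausdorff_Euclidean_space)

text \<open>The orthant is closed in a product of copies of [-1, 1], which is compact by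
  Tychonoff.\<close>

lemma compact_orthant_sphere: "compact_space (orthant_sphere d)"
proof -
  let ?P = "powertop_real (UNIV::nat set)"
  let ?S = "{v::nat \<Rightarrow> real. (\<Sum>i\<le>d. v i ^ 2) = 1 \<and> (\<forall>i>d. v i = 0) \<and> (\<forall>i\<ge>2. 0 \<le> v i)}"
  have proj: "continuous_map ?P euclideanreal (\<lambda>v. v k)" for k
    by (intro continuous_map_product_projection) simp
  have "continuous_map ?P euclideanreal (\<lambda>v. \<Sum>i\<le>d. v i ^ 2)"
    by (intro continuous_intros proj) auto
  then have "closedin ?P {v \<in> topspace ?P. (\<Sum>i\<le>d. v i ^ 2) \<in> {1}}"
    by (rule closedin_continuous_map_preimage) simp
  moreover have "closedin ?P {v \<in> topspace ?P. v i \<in> {0}}" for i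
    by (rule closedin_continuous_map_preimage[OF proj]) simp
  moreover have "closedin ?P {v \<in> topspace ?P. v i \<in> {0..}}" for i
    by (rule closedin_continuous_map_preimage[OF proj]) simp
  ultimately have "closedin ?P ({v \<in> topspace ?P. (\<Sum>i\<le>d. v i ^ 2) \<in> {1}} \<inter>
      ((\<Inter>i\<in>{d<..}. {v \<in> topspace ?P. v i \<in> {0}}) \<inter> (\<Inter>i\<in>{2..}. {v \<in> topspace ?P. v i \<in> {0..}})))"
    by (intro closedin_Int closedin_Inter) auto
  moreover have "\<dots> = ?S"
    by auto
  ultimately have closed: "closedin ?P ?S"
    by simp
  have "?S \<subseteq> (\<Pi>\<^sub>E i\<in>UNIV. {-1..1})"
  proof
    fix v assume v: "v \<in> ?S"
    have "v k \<in> {-1..1}" for k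
    proof (cases "k \<le> d")
      case True
      then have "v k ^ 2 \<le> (\<Sum>i\<le>d. v i ^ 2)"
        by (intro member_le_sum) auto
      with v have "\<bar>v k\<bar> \<le> 1"
        by (simp add: abs_square_le_1)
      then show ?thesis by auto
    qed (use v in auto)
    then show "v \<in> (\<Pi>\<^sub>E i\<in>UNIV. {-1..1})" by auto
  qed
  moreover have "compactin ?P (\<Pi>\<^sub>E i\<in>UNIV. {-1..1})"
    by (simp add: compactin_PiE)
  ultimately have "compactin ?P ?S"
    using closed_compactin closed by blast
  then show ?thesis
    unfolding orthant_sphere_alt by (rule compact_space_subtopology)
qed

lemma in_nsphere1_orthant_sphere:
  assumes "d \<ge> 1"
  shows "v \<in> topspace (nsphere 1) \<longleftrightarrow> v \<in> topspace (orthant_sphere d) \<and> (\<forall>i\<ge>2. v i = 0)"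
proof -
  have "(\<Sum>i\<le>d. v i ^ 2) = v 0 ^ 2 + v 1 ^ 2" if "\<forall>i\<ge>2. v i = 0"
  proof -
    have "(\<Sum>i\<le>d. v i ^ 2) = (\<Sum>i\<le>1. v i ^ 2)"
      by (rule sum.mono_neutral_right) (use that assms in auto)
    then show ?thesis by simp
  qed
  then show ?thesis
    unfolding in_nsphere1 in_orthant_sphere using assms by auto
qed

lemma subtopology_orthant_sphere_nsphere1:
  assumes "d \<ge> 1"
  shows "subtopology (orthant_sphere d) (topspace (nsphere 1)) = nsphere 1"
proof -
  have "topspace (orthant_sphere d) \<inter> topspace (nsphere 1) = topspace (nsphere 1)"
    using in_nsphere1_orthant_sphere[OF assms] by blast
  moreover have "topspace (orthant_sphere d) = {v. (\<Sum>i\<le>d. v i ^ 2) = 1 \<and> (\<forall>i>d. v i = 0) \<and> (\<forall>i\<ge>2. 0 \<le> v i)}"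
    using in_orthant_sphere by blast
  moreover have "nsphere 1 = subtopology (powertop_real UNIV) (topspace (nsphere 1))"
    by (simp add: nsphere)
  ultimately show ?thesis
    unfolding orthant_sphere_alt subtopology_subtopology by metis
qed

text \<open>Supplies the closed set for Tietze's theorem: the circle is an intersection of zero sets
  of coordinates.\<close>

lemma closedin_nsphere1_orthant_sphere:
  assumes "d \<ge> 1"
  shows "closedin (orthant_sphere d) (topspace (nsphere 1))"
proof -
  have "closedin (orthant_sphere d) (\<Inter>i\<in>{2..}. {v \<in> topspace (orthant_sphere d). v i \<in> {0}})"
    by (intro closedin_INT closedin_continuous_map_preimage[OF continuous_map_orthant_sphere_projection]) auto
  moreover have "(\<Inter>i\<in>{2..}. {v \<in> topspace (orthant_sphere d). v i \<in> {0}}) = topspace (nsphere 1)"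
    using in_nsphere1_orthant_sphere[OF assms] by auto
  ultimately show ?thesis by simp
qed

section \<open>Homotopies through wall-keeping maps\<close>

lemma homotopic_with_keeps_walls_iff:
  "homotopic_with (keeps_walls d) (orthant_sphere d) Y f g \<longleftrightarrow>
     (\<exists>h. continuous_map (prod_topology (top_of_set {0..1::real}) (orthant_sphere d)) Y h \<and>
        (\<forall>v\<in>topspace (orthant_sphere d). h (0, v) = f v) \<and>
        (\<forall>v\<in>topspace (orthant_sphere d). h (1, v) = g v) \<and>
        (\<forall>s\<in>{0..1}. keeps_walls d (\<lambda>v. h (s, v))))"
  \<comment> \<open>\<open>keeps_walls\<close> depends only on values on the orthant, so the ends of
    a homotopy have to match only there.\<close>
  by (rule homotopic_with) (simp add: keeps_walls_def)

lemma rot_in_orthant_sphere: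
  assumes "d \<ge> 1"
  shows "rot a v \<in> topspace (orthant_sphere d) \<longleftrightarrow> v \<in> topspace (orthant_sphere d)"
proof -
  have "(\<Sum>i\<le>d. x i ^ 2) = x 0 ^ 2 + x 1 ^ 2 + (\<Sum>i=2..d. x i ^ 2)" for x :: "nat \<Rightarrow> real"
    using assms by (simp add: numeral_2_eq_2 atMost_atLeast0 sum.atLeast_Suc_atMost)
  moreover have "rot a v 0 ^ 2 + rot a v 1 ^ 2 = v 0 ^ 2 + v 1 ^ 2"
  proof -
    have "(c * x - s * y)\<^sup>2 + (s * x + c * y)\<^sup>2 = (s\<^sup>2 + c\<^sup>2) * (x\<^sup>2 + y\<^sup>2)" for c s x y :: real
      by (simp add: power2_eq_square algebra_simps)
    then show ?thesis
      by (simp add: rot_def)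
  qed
  moreover have "rot a v i = v i" if "i \<ge> 2" for i
    using that by (simp add: rot_def)
  ultimately show ?thesis
    unfolding in_orthant_sphere using assms by simp
qed

text \<open>The angle is scaled from 0 to \<open>h v\<close>. Rotation alters only coordinates 0 and
  1, so at every stage the later coordinates are those of \<open>g v\<close>.\<close>

lemma homotopic_rotation:
  assumes "d \<ge> 1" and g: "continuous_map (orthant_sphere d) (orthant_sphere d) g" "keeps_walls d g"
    and h: "continuous_map (orthant_sphere d) euclideanreal h"
  shows "homotopic_with (keeps_walls d) (orthant_sphere d) (orthant_sphere d) g (\<lambda>v. rot (h v) (g v))"
proof -
  let ?Q = "orthant_sphere d"
  let ?I = "prod_topology (top_of_set {0..1::real}) ?Q"
  have fst: "continuous_map ?I euclideanreal fst"
    by (metis continuous_map_fst continuous_map_in_subtopology)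
  have h': "continuous_map ?I euclideanreal (\<lambda>p. h (snd p))"
    using continuous_map_compose[OF continuous_map_snd h] by (simp add: o_def)
  have g': "continuous_map ?I euclideanreal (\<lambda>p. g (snd p) k)" for k
    using continuous_map_compose[OF continuous_map_snd g(1), of "top_of_set {0..1::real}"]
    unfolding continuous_map_into_orthant_sphere by (simp add: o_def)
  have "continuous_map ?I euclideanreal (\<lambda>p. sin (fst p * h (snd p)))"
       "continuous_map ?I euclideanreal (\<lambda>p. cos (fst p * h (snd p)))"
    using continuous_map_compose[OF continuous_map_real_mult[OF fst h'], of euclideanreal sin]
      continuous_map_compose[OF continuous_map_real_mult[OF fst h'], of euclideanreal cos]
    by (simp_all add: o_def continuous_on_sin_real continuous_on_cos_real continuous_intros)
  then have "continuous_map ?I euclideanreal (\<lambda>p. rot (fst p * h (snd p)) (g (snd p)) k)" for k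
    unfolding rot_def by (cases "k = 0"; cases "k = 1") (auto intro!: continuous_intros g')
  moreover have "g v \<in> topspace ?Q" if "v \<in> topspace ?Q" for v
    using g(1) that unfolding continuous_map_into_orthant_sphere by blast
  ultimately have "continuous_map ?I ?Q (\<lambda>p. rot (fst p * h (snd p)) (g (snd p)))"
    unfolding continuous_map_into_orthant_sphere by (auto simp: rot_in_orthant_sphere[OF assms(1)])
  moreover have "keeps_walls d (\<lambda>v. rot (s * h v) (g v))" for s
    using g(2) by (simp add: keeps_walls_def rot_def)
  moreover have "rot 0 v = v" for v
    by (auto simp: rot_def)
  ultimately show ?thesis
    unfolding homotopic_with_keeps_walls_iff
    by (intro exI[of _ "\<lambda>p. rot (fst p * h (snd p)) (g (snd p))"]) auto
qed

lemma normalize_in_orthant_sphere: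
  assumes "\<exists>i\<le>d. w i \<noteq> 0" "\<And>i. i > d \<Longrightarrow> w i = 0" "\<And>i. i \<ge> 2 \<Longrightarrow> 0 \<le> w i"
  shows "(\<lambda>i. w i / sqrt (\<Sum>j\<le>d. w j ^ 2)) \<in> topspace (orthant_sphere d)"
proof -
  have "0 < (\<Sum>j\<le>d. w j ^ 2)"
    using assms(1) by (auto intro!: sum_pos2)
  moreover from this have "(\<Sum>i\<le>d. (w i / sqrt (\<Sum>j\<le>d. w j ^ 2)) ^ 2) = 1"
    by (simp add: power_divide flip: sum_divide_distrib)
  ultimately show ?thesis
    unfolding in_orthant_sphere using assms by (auto intro!: divide_nonneg_nonneg)
qed

lemma homotopic_agree_on_circle:
  assumes "d \<ge> 1"
    and f: "continuous_map (orthant_sphere d) (orthant_sphere d) f" "keeps_walls d f"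
    and g: "continuous_map (orthant_sphere d) (orthant_sphere d) g" "keeps_walls d g"
    and eq: "\<And>v. v \<in> topspace (nsphere 1) \<Longrightarrow> f v = g v"
  shows "homotopic_with (keeps_walls d) (orthant_sphere d) (orthant_sphere d) f g"
proof -
  let ?Q = "orthant_sphere d"
  let ?I = "prod_topology (top_of_set {0..1::real}) ?Q"
  \<comment> \<open>The segment from \<open>f v\<close> to \<open>g v\<close> meets the origin only
    if the two are antipodal, and then both lie on the circle. The last summand moves such segments
    off the origin; it vanishes at the end times and on the wall \<open>v i = 0\<close>.\<close>
  define w where "w = (\<lambda>p i. (1 - fst p) * f (snd p) i + fst p * g (snd p) i +
    (if i \<ge> 2 then fst p * (1 - fst p) * snd p i else 0))"
  define H where "H = (\<lambda>p i. w p i / sqrt (\<Sum>j\<le>d. w p j ^ 2))"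
  have im: "f v \<in> topspace ?Q" "g v \<in> topspace ?Q" if "v \<in> topspace ?Q" for v
    using f(1) g(1) that unfolding continuous_map_into_orthant_sphere by blast+
  have nz: "\<exists>i\<le>d. v i \<noteq> 0" if "v \<in> topspace ?Q" for v
  proof (rule ccontr)
    assume "\<not> (\<exists>i\<le>d. v i \<noteq> 0)"
    then have "(\<Sum>i\<le>d. v i ^ 2) = 0"
      by simp
    with that show False
      by (simp add: in_orthant_sphere)
  qed
  have w_nonneg: "0 \<le> w (s, v) i" if "s \<in> {0..1}" "v \<in> topspace ?Q" "i \<ge> 2" for s v i
    using that im[of v] unfolding in_orthant_sphere w_def
    by (auto intro!: add_nonneg_nonneg mult_nonneg_nonneg)
  have w_nz: "\<exists>i\<le>d. w (s, v) i \<noteq> 0" if s: "s \<in> {0..1}" and v: "v \<in> topspace ?Q" for s v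
  \<comment> \<open>In these cases \<open>w (s, v)\<close> is itself \<open>f v\<close> or
    \<open>g v\<close>, a unit vector; otherwise the extra summand makes some coordinate
    positive.\<close>
  proof (cases "s = 0 \<or> s = 1 \<or> (\<forall>i\<ge>2. v i = 0)")
    case True
    moreover have "f v = g v" if "\<forall>i\<ge>2. v i = 0"
      using that v eq in_nsphere1_orthant_sphere[OF assms(1)] by blast
    ultimately have "w (s, v) = f v \<or> w (s, v) = g v"
      by (auto simp: w_def fun_eq_iff algebra_simps)
    with nz im v show ?thesis by metis
  next
    case False
    then obtain i where i: "i \<ge> 2" "v i \<noteq> 0" and s': "0 < s" "s < 1"
      using s by auto
    then have "i \<le> d" "0 < v i"
      using v unfolding in_orthant_sphere by (meson not_le, metis order_less_le)
    then have "0 < s * (1 - s) * v i"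
      using s' by simp
    moreover have "0 \<le> (1 - s) * f v i" "0 \<le> s * g v i"
      using im[OF v] i s' unfolding in_orthant_sphere by auto
    ultimately have "0 < w (s, v) i"
      using i by (simp add: w_def)
    with \<open>i \<le> d\<close> show ?thesis by force
  qed
  have w_out: "w (s, v) i = 0" if "v \<in> topspace ?Q" "i > d" for s v i
    using that im[of v] unfolding in_orthant_sphere w_def by simp
  have fst: "continuous_map ?I euclideanreal fst"
    by (metis continuous_map_fst continuous_map_in_subtopology)
  have comp: "continuous_map ?I euclideanreal (\<lambda>p. f (snd p) k)"
       "continuous_map ?I euclideanreal (\<lambda>p. g (snd p) k)"
       "continuous_map ?I euclideanreal (\<lambda>p. snd p k)" for k
    using continuous_map_compose[OF continuous_map_snd f(1), of "top_of_set {0..1::real}"]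
      continuous_map_compose[OF continuous_map_snd g(1), of "top_of_set {0..1::real}"]
      continuous_map_compose[OF continuous_map_snd continuous_map_orthant_sphere_projection, of "top_of_set {0..1::real}"]
    unfolding continuous_map_into_orthant_sphere by (simp_all add: o_def)
  have contw: "continuous_map ?I euclideanreal (\<lambda>p. w p k)" for k
    unfolding w_def by (cases "k \<ge> 2") (auto intro!: continuous_intros fst comp)
  have contN: "continuous_map ?I euclideanreal (\<lambda>p. sqrt (\<Sum>j\<le>d. w p j ^ 2))"
    by (intro continuous_intros contw) auto
  have N: "sqrt (\<Sum>j\<le>d. w p j ^ 2) \<noteq> 0" if "p \<in> topspace ?I" for p
  proof -
    have "\<exists>i\<le>d. w p i \<noteq> 0"
      using w_nz that by (cases p) auto
    then show ?thesis
      by (auto simp: sum_nonneg_eq_0_iff)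
  qed
  have "continuous_map ?I euclideanreal (\<lambda>p. H p k)" for k
    unfolding H_def by (rule continuous_map_real_divide[OF contw contN N])
  moreover have "H p \<in> topspace ?Q" if "p \<in> topspace ?I" for p
  proof -
    obtain s v where "p = (s, v)" "s \<in> {0..1}" "v \<in> topspace ?Q"
      using \<open>p \<in> topspace ?I\<close> by auto
    then show ?thesis
      unfolding H_def using w_nz[of s v] w_out[of v _ s] w_nonneg[of s v]
      by (intro normalize_in_orthant_sphere) simp_all
  qed
  ultimately have "continuous_map ?I ?Q H"
    unfolding continuous_map_into_orthant_sphere by blast
  moreover have "H (0, v) = f v" "H (1, v) = g v" if "v \<in> topspace ?Q" for v
  proof -
    have "w (0, v) = f v" "w (1, v) = g v"
      by (simp_all add: w_def fun_eq_iff)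
    then show "H (0, v) = f v" "H (1, v) = g v"
      using im[OF that] unfolding in_orthant_sphere by (simp_all add: H_def)
  qed
  moreover have "keeps_walls d (\<lambda>v. H (s, v))" for s
    using f(2) g(2) by (auto simp: keeps_walls_def H_def w_def)
  ultimately show ?thesis
    unfolding homotopic_with_keeps_walls_iff by blast
qed

text \<open>Tietze extends the angle from the circle, which is closed in the normal space
  \<open>orthant_sphere d\<close>. Rotating \<open>g\<close> by the extended angle makes it agree
  with \<open>f\<close> on the circle.\<close>

lemma homotopic_rotated_on_circle:
  assumes "d \<ge> 1"
    and f: "continuous_map (orthant_sphere d) (orthant_sphere d) f" "keeps_walls d f"
    and g: "continuous_map (orthant_sphere d) (orthant_sphere d) g" "keeps_walls d g"
    and h: "continuous_map (nsphere 1) euclideanreal h"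
    and rot: "\<And>v. v \<in> topspace (nsphere 1) \<Longrightarrow> f v = rot (h v) (g v)"
  shows "homotopic_with (keeps_walls d) (orthant_sphere d) (orthant_sphere d) f g"
proof -
  let ?Q = "orthant_sphere d"
  have "normal_space ?Q"
    using compact_Hausdorff_or_regular_imp_normal_space[OF compact_orthant_sphere] Hausdorff_orthant_sphere by blast
  then obtain k where k: "continuous_map ?Q euclideanreal k" "\<And>v. v \<in> topspace (nsphere 1) \<Longrightarrow> k v = h v"
    using Tietze_extension_realinterval[OF _ closedin_nsphere1_orthant_sphere[OF assms(1)] is_interval_univ, of h]
      h subtopology_orthant_sphere_nsphere1[OF assms(1)] by auto
  have *: "homotopic_with (keeps_walls d) ?Q ?Q g (\<lambda>v. rot (k v) (g v))"
    using homotopic_rotation[OF assms(1) g k(1)] .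
  have "homotopic_with (keeps_walls d) ?Q ?Q f (\<lambda>v. rot (k v) (g v))"
  proof (rule homotopic_agree_on_circle[OF assms(1) f])
    show "continuous_map ?Q ?Q (\<lambda>v. rot (k v) (g v))"
      using * homotopic_with_imp_continuous_maps by blast
    show "keeps_walls d (\<lambda>v. rot (k v) (g v))"
      using * homotopic_with_imp_property by blast
  qed (use rot k(2) in auto)
  with * show ?thesis
    using homotopic_with_trans[OF _ homotopic_with_symD] by blast
qed

section \<open>Stereographic projection of the chamber\<close>

text \<open>A continuous bijection from a compact space to a Hausdorff space is a homeomorphism, so
  the work lies in continuity at infinity.\<close>

lemma homeomorphic_map_Alexandroff_compactification:
  assumes Y: "compact_space Y" "Hausdorff_space Y" "a \<in> topspace Y"
    and e: "homeomorphic_maps X (subtopology Y (topspace Y - {a})) e e'"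
  shows "homeomorphic_map (Alexandroff_compactification X) Y (case_option a e)"
proof -
  let ?A = "Alexandroff_compactification X"
  let ?E = "case_option a e"
  have conte: "continuous_map X Y e" and conte': "continuous_map (subtopology Y (topspace Y - {a})) X e'"
    using e by (auto simp: homeomorphic_maps_def continuous_map_in_subtopology)
  have e_in: "e x \<in> topspace Y" "e x \<noteq> a" "e' (e x) = x" if "x \<in> topspace X" for x
    using e that continuous_map_image_subset_topspace[of X] by (fastforce simp: homeomorphic_maps_def)+
  have e'_in: "e' y \<in> topspace X" "e (e' y) = y" if "y \<in> topspace Y" "y \<noteq> a" for y
    using e that continuous_map_image_subset_topspace[OF conte'] by (auto simp: homeomorphic_maps_def)
  show ?thesis
  proof (rule continuous_imp_homeomorphic_map[OF _ _ Y(2)])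
    show "continuous_map ?A Y ?E"
      unfolding continuous_map
    proof (intro conjI allI impI)
      show "?E ` topspace ?A \<subseteq> topspace Y"
        using e_in Y(3) by auto
      fix V assume V: "openin Y V"
      have U: "openin X {x \<in> topspace X. e x \<in> V}"
        using openin_continuous_map_preimage[OF conte V] .
      show "openin ?A {z \<in> topspace ?A. ?E z \<in> V}"
      proof (cases "a \<in> V")
        case True
        \<comment> \<open>\<open>?K\<close> is the set that the neighbourhood of infinity omits: the
          complement of \<open>V\<close> avoids \<open>a\<close>, is compact in \<open>Y\<close>,
          and is carried onto \<open>?K\<close> by \<open>e'\<close>.\<close>
        let ?K = "{x \<in> topspace X. e x \<notin> V}"
        have "closedin Y (topspace Y - V)"
          using V by blast
        then have "compactin Y (topspace Y - V)"
          using Y(1) closedin_compact_space by blast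
        then have "compactin (subtopology Y (topspace Y - {a})) (topspace Y - V)"
          using True by (auto simp: compactin_subtopology)
        then have "compactin X (e' ` (topspace Y - V))"
          using conte' image_compactin by blast
        moreover have "e' ` (topspace Y - V) = ?K"
        proof
          show "e' ` (topspace Y - V) \<subseteq> ?K"
          proof
            fix x assume "x \<in> e' ` (topspace Y - V)"
            then obtain y where "x = e' y" "y \<in> topspace Y" "y \<notin> V" "y \<noteq> a"
              using True by blast
            then show "x \<in> ?K"
              using e'_in[of y] by simp
          qed
          show "?K \<subseteq> e' ` (topspace Y - V)"
          proof
            fix x assume "x \<in> ?K"
            then have "e x \<in> topspace Y - V" "x = e' (e x)"
              using e_in[of x] by simp_all
            then show "x \<in> e' ` (topspace Y - V)"
              by blast
          qed
        qed
        moreover have "closedin X (topspace X - {x \<in> topspace X. e x \<in> V})"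
          using U by blast
        moreover have "topspace X - {x \<in> topspace X. e x \<in> V} = ?K"
          by blast
        moreover have "{z \<in> topspace ?A. ?E z \<in> V} = insert None (Some ` (topspace X - ?K))"
          using True by auto
        ultimately show ?thesis
          unfolding openin_Alexandroff_compactification by (intro disjI2 exI[of _ ?K]) simp
      next
        case False
        then have "{z \<in> topspace ?A. ?E z \<in> V} = Some ` {x \<in> topspace X. e x \<in> V}"
          by auto
        then show ?thesis
          using U by simp
      qed
    qed
    show "?E ` topspace ?A = topspace Y"
    proof
      show "?E ` topspace ?A \<subseteq> topspace Y"
        using e_in Y(3) by auto
      show "topspace Y \<subseteq> ?E ` topspace ?A"
      proof
        fix y assume "y \<in> topspace Y"
        then have "y = ?E (if y = a then None else Some (e' y)) \<and> (if y = a then None else Some (e' y)) \<in> topspace ?A"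
          using e'_in by simp
        then show "y \<in> ?E ` topspace ?A" by blast
      qed
    qed
    show "inj_on ?E (topspace ?A)"
    proof (rule inj_onI)
      fix x y assume "x \<in> topspace ?A" "y \<in> topspace ?A" "?E x = ?E y"
      then show "x = y"
        using e_in by (cases x; cases y) (auto, metis+)
    qed
  qed simp
qed

section \<open>Stereographic coordinates on the chamber\<close>

lemma in_D': "t \<in> topspace (D' d) \<longleftrightarrow> (\<forall>i\<ge>d. t i = 0) \<and> (\<forall>i. Suc i < d \<longrightarrow> t i \<le> t (Suc i))"
  by (auto simp: D'_def topspace_Euclidean_space)

lemma D'_alt: "D' d = subtopology (powertop_real UNIV) (topspace (D' d))"
  by (simp add: D'_def Euclidean_space_def subtopology_subtopology)

lemma continuous_map_into_D':
  "continuous_map X (D' d) f \<longleftrightarrow>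
     (\<forall>k. continuous_map X euclideanreal (\<lambda>x. f x k)) \<and> (\<forall>x\<in>topspace X. f x \<in> topspace (D' d))"
  by (subst D'_alt) (auto simp: continuous_map_in_subtopology continuous_map_componentwise_UNIV)

lemma continuous_map_D'_projection: "continuous_map (D' d) euclideanreal (\<lambda>t. t k)"
  using continuous_map_into_D'[of "D' d" d "\<lambda>t. t"] by simp

text \<open>The value at index 0 is irrelevant. The shift by one makes the coordinate \<open>i + 2\<close> of
  \<open>stereo d t\<close> vanish exactly on the face \<^term>\<open>F' d i\<close>.\<close>

definition gap :: "(nat \<Rightarrow> real) \<Rightarrow> nat \<Rightarrow> real" where
  "gap t i = (if i = 1 then t 0 else t (i - 1) - t (i - 2))"

text \<open>Inverse stereographic projection from \<open>pole\<close>,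
  \<open>x \<mapsto> (|x|^2 - 1, 2 x) / (|x|^2 + 1)\<close>, applied to the vector \<open>x\<close>
  of gaps; \<open>S\<close> is \<open>|x|^2\<close>.\<close>

definition stereo :: "nat \<Rightarrow> (nat \<Rightarrow> real) \<Rightarrow> nat \<Rightarrow> real" where
  "stereo d t = (\<lambda>i. let S = (\<Sum>j=1..d. gap t j ^ 2) in
     if i = 0 then (S - 1) / (S + 1) else if i \<le> d then 2 * gap t i / (S + 1) else 0)"

text \<open>Stereographic projection \<open>v i / (1 - v 0)\<close> returns the gaps, and their
  partial sums return the coordinates of the chamber point.\<close>

definition unstereo :: "nat \<Rightarrow> (nat \<Rightarrow> real) \<Rightarrow> nat \<Rightarrow> real" where
  "unstereo d v = (\<lambda>k. if k < d then \<Sum>i=1..Suc k. v i / (1 - v 0) else 0)"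

definition pole :: "nat \<Rightarrow> real" where
  "pole = (\<lambda>i. if i = 0 then 1 else 0)"

lemma pole_in_orthant_sphere: "pole \<in> topspace (orthant_sphere d)"
  unfolding in_orthant_sphere by (simp add: pole_def if_distrib[where f = "\<lambda>x. x ^ 2"] cong: if_cong)

lemma sum_atMost_split0:
  fixes f :: "nat \<Rightarrow> real"
  shows "(\<Sum>i\<le>d. f i) = f 0 + (\<Sum>i=1..d. f i)"
  by (simp add: atMost_atLeast0 sum.atLeast_Suc_atMost)

text \<open>On the unit sphere \<open>v 0 \<ge> 1\<close> forces the other coordinates to vanish.
  This makes the denominator \<open>1 - v 0\<close> of the projection positive.\<close>

lemma less_one_of_not_pole:
  assumes v: "v \<in> topspace (orthant_sphere d)" "v \<noteq> pole"
  shows "v 0 < 1"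
proof (rule ccontr)
  have sum: "v 0 ^ 2 + (\<Sum>i=1..d. v i ^ 2) = 1"
    using v(1) unfolding in_orthant_sphere sum_atMost_split0 by simp
  assume "\<not> v 0 < 1"
  then have "1 \<le> v 0 ^ 2"
    by (simp add: one_le_power)
  moreover have "0 \<le> (\<Sum>i=1..d. v i ^ 2)"
    by (simp add: sum_nonneg)
  ultimately have z: "(\<Sum>i=1..d. v i ^ 2) = 0" "v 0 ^ 2 = 1"
    using sum by linarith+
  have "v i = pole i" for i
  proof (cases "i = 0")
    case True
    then show ?thesis
      using z(2) \<open>\<not> v 0 < 1\<close> by (auto simp: pole_def power2_eq_1_iff)
  next
    case False
    then show ?thesis
      using z(1) v(1) by (cases "i \<le> d") (auto simp: pole_def in_orthant_sphere sum_nonneg_eq_0_iff)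
  qed
  with v(2) show False by blast
qed

text \<open>The norm is one by \<open>(S - 1)^2 + 4 S = (S + 1)^2\<close>. The ordering of the
  coordinates of \<open>t\<close> makes the gaps from index 2 on nonnegative. The pole is missed
  because \<open>(S - 1) / (S + 1)\<close> is never 1.\<close>

lemma stereo_in_orthant_sphere:
  assumes "t \<in> topspace (D' d)"
  shows "stereo d t \<in> topspace (orthant_sphere d) - {pole}"
proof -
  define S where "S = (\<Sum>j=1..d. gap t j ^ 2)"
  have S: "0 \<le> S"
    by (simp add: S_def sum_nonneg)
  have st: "stereo d t i = (if i = 0 then (S - 1) / (S + 1) else if i \<le> d then 2 * gap t i / (S + 1) else 0)" for i
    by (simp add: stereo_def S_def Let_def)
  have "(\<Sum>i=1..d. stereo d t i ^ 2) = (\<Sum>i=1..d. 4 / (S + 1) ^ 2 * gap t i ^ 2)"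
    by (rule sum.cong) (auto simp: st power_divide power_mult_distrib)
  also have "\<dots> = 4 * S / (S + 1) ^ 2"
    unfolding sum_distrib_left[symmetric] S_def[symmetric] by simp
  finally have "(\<Sum>i\<le>d. stereo d t i ^ 2) = ((S - 1) ^ 2 + 4 * S) / (S + 1) ^ 2"
    unfolding sum_atMost_split0 by (simp add: st power_divide add_divide_distrib)
  also have "(S - 1) ^ 2 + 4 * S = (S + 1) ^ 2"
    by (simp add: power2_eq_square algebra_simps)
  also have "(S + 1) ^ 2 / (S + 1) ^ 2 = 1"
    using S by simp
  finally have 1: "(\<Sum>i\<le>d. stereo d t i ^ 2) = 1" .
  have "0 \<le> stereo d t i" if "i \<ge> 2" for i
  proof (cases "i \<le> d")
    case True
    then have "t (i - 2) \<le> t (Suc (i - 2))"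
      using assms that unfolding in_D' by auto
    moreover have "Suc (i - 2) = i - 1"
      using that by simp
    ultimately show ?thesis
      using that S by (simp add: st gap_def)
  qed (use that in \<open>simp add: st\<close>)
  moreover have "stereo d t \<noteq> pole"
  proof
    assume "stereo d t = pole"
    then have "(S - 1) / (S + 1) = 1"
      using st[of 0] by (simp add: pole_def)
    with S show False by (simp add: field_simps)
  qed
  ultimately show ?thesis
    using 1 by (auto simp: in_orthant_sphere st)
qed

lemma unstereo_in_D':
  assumes "v \<in> topspace (orthant_sphere d)" "v \<noteq> pole"
  shows "unstereo d v \<in> topspace (D' d)"
proof -
  have "0 \<le> v (Suc (Suc i)) / (1 - v 0)" for i
    using assms less_one_of_not_pole[OF assms] unfolding in_orthant_sphere by simp
  then show ?thesis
    by (auto simp: in_D' unstereo_def)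
qed

text \<open>The sum telescopes, starting from \<open>gap t 1 = t 0\<close>.\<close>

lemma sum_gap: "(\<Sum>i=1..Suc k. gap t i) = t k"
  by (induction k) (auto simp: gap_def)

text \<open>Since \<open>1 - stereo d t 0 = 2 / (S + 1)\<close>, the division in
  \<open>unstereo\<close> cancels the denominator and leaves the gaps.\<close>

lemma unstereo_stereo:
  assumes "t \<in> topspace (D' d)"
  shows "unstereo d (stereo d t) = t"
proof
  fix k
  define S where "S = (\<Sum>j=1..d. gap t j ^ 2)"
  have S: "0 \<le> S"
    by (simp add: S_def sum_nonneg)
  have st: "stereo d t i = (if i = 0 then (S - 1) / (S + 1) else if i \<le> d then 2 * gap t i / (S + 1) else 0)" for i
    by (simp add: stereo_def S_def Let_def)
  have "stereo d t i / (1 - stereo d t 0) = gap t i" if "i \<in> {1..d}" for i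
    using that S by (simp add: st field_simps)
  then have "(\<Sum>i=1..Suc k. stereo d t i / (1 - stereo d t 0)) = (\<Sum>i=1..Suc k. gap t i)" if "k < d"
    by (intro sum.cong) (use that in auto)
  then show "unstereo d (stereo d t) k = t k"
    using assms unfolding sum_gap in_D' by (simp add: unstereo_def)
qed

text \<open>The gaps of \<open>unstereo d v\<close> are \<open>v j / (1 - v 0)\<close>, and the
  sphere equation turns the sum of their squares into \<open>S = (1 + v 0) / (1 - v 0)\<close>.
  Substituting this in \<open>stereo\<close> returns \<open>v\<close>.\<close>

lemma stereo_unstereo:
  assumes v: "v \<in> topspace (orthant_sphere d)" "v \<noteq> pole"
  shows "stereo d (unstereo d v) = v"
proof
  fix i
  note v0 = less_one_of_not_pole[OF v]
  have gap: "gap (unstereo d v) j = v j / (1 - v 0)" if "j \<in> {1..d}" for j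
  proof (cases "j = 1")
    case False
    with that obtain m where "j = Suc (Suc m)" "Suc m < d"
      by (metis One_nat_def Suc_le_eq atLeastAtMost_iff not0_implies_Suc not_less_eq_eq le_zero_eq)
    then show ?thesis
      by (simp add: gap_def unstereo_def)
  qed (use that in \<open>simp add: gap_def unstereo_def\<close>)
  define S where "S = (\<Sum>j=1..d. gap (unstereo d v) j ^ 2)"
  have "(\<Sum>j=1..d. v j ^ 2) = 1 - v 0 ^ 2"
    using v(1) unfolding in_orthant_sphere sum_atMost_split0 by simp
  moreover have "S = (\<Sum>j=1..d. v j ^ 2 / (1 - v 0) ^ 2)"
    unfolding S_def by (rule sum.cong) (auto simp: gap power_divide)
  ultimately have "S = (1 - v 0 ^ 2) / (1 - v 0) ^ 2"
    by (simp flip: sum_divide_distrib)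
  also have "1 - v 0 ^ 2 = (1 + v 0) * (1 - v 0)"
    by (simp add: power2_eq_square algebra_simps)
  also have "\<dots> / (1 - v 0) ^ 2 = (1 + v 0) / (1 - v 0)"
    by (simp add: power2_eq_square)
  finally have S: "S = (1 + v 0) / (1 - v 0)" .
  have S1: "S + 1 = 2 / (1 - v 0)" "S - 1 = 2 * v 0 / (1 - v 0)"
    using v0 unfolding S by (simp_all add: field_simps)
  have st: "stereo d (unstereo d v) i = (if i = 0 then (S - 1) / (S + 1)
      else if i \<le> d then 2 * gap (unstereo d v) i / (S + 1) else 0)"
    by (simp add: stereo_def S_def Let_def)
  show "stereo d (unstereo d v) i = v i"
    using v0 v(1) gap[of i] unfolding st S1 in_orthant_sphere by auto
qed

lemma homeomorphic_maps_stereo: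
  "homeomorphic_maps (D' d) (subtopology (orthant_sphere d) (topspace (orthant_sphere d) - {pole}))
     (stereo d) (unstereo d)"
proof -
  let ?Q = "orthant_sphere d"
  let ?Q' = "subtopology ?Q (topspace ?Q - {pole})"
  have gap: "continuous_map (D' d) euclideanreal (\<lambda>t. gap t j)" for j
    unfolding gap_def
    by (cases "j = 1") (auto intro!: continuous_intros continuous_map_D'_projection)
  have S: "continuous_map (D' d) euclideanreal (\<lambda>t. \<Sum>j=1..d. gap t j ^ 2)"
    by (intro continuous_intros gap) auto
  have nz: "(\<Sum>j=1..d. gap t j ^ 2) + 1 \<noteq> 0" for t
    using sum_nonneg[of "{1..d}" "\<lambda>j. gap t j ^ 2"] by (simp add: add_nonneg_eq_0_iff)
  have "continuous_map (D' d) euclideanreal (\<lambda>t. stereo d t k)" for k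
    unfolding stereo_def Let_def
    by (cases "k = 0"; cases "k \<le> d") (auto intro!: continuous_intros S gap simp: nz[simplified])
  then have "continuous_map (D' d) ?Q' (stereo d)"
    using stereo_in_orthant_sphere
    unfolding continuous_map_in_subtopology continuous_map_into_orthant_sphere by blast
  moreover have proj: "continuous_map ?Q' euclideanreal (\<lambda>v. v k)" for k
    by (intro continuous_map_from_subtopology continuous_map_orthant_sphere_projection)
  have "continuous_map ?Q' euclideanreal (\<lambda>v. v i / (1 - v 0))" for i
    by (intro continuous_intros proj) (use less_one_of_not_pole in force)
  then have "continuous_map ?Q' euclideanreal (\<lambda>v. unstereo d v k)" for k
    unfolding unstereo_def by (cases "k < d") (auto intro!: continuous_map_sum simp del: sum.cl_ivl_Suc)
  then have "continuous_map ?Q' (D' d) (unstereo d)"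
    unfolding continuous_map_into_D' using unstereo_in_D' by auto
  ultimately show ?thesis
    unfolding homeomorphic_maps_def using unstereo_stereo stereo_unstereo by auto
qed

section \<open>Faces of the compactified chamber as walls of the orthant\<close>

definition to_sphere :: "nat \<Rightarrow> (nat \<Rightarrow> real) option \<Rightarrow> nat \<Rightarrow> real" where
  "to_sphere d = case_option pole (stereo d)"

lemma topspace_D: "topspace (D d) = insert None (Some ` topspace (D' d))"
  by (simp add: D_def)

lemma homeomorphic_map_to_sphere: "homeomorphic_map (D d) (orthant_sphere d) (to_sphere d)"
  unfolding D_def to_sphere_def
  by (rule homeomorphic_map_Alexandroff_compactification[OF compact_orthant_sphere Hausdorff_orthant_sphere
      pole_in_orthant_sphere homeomorphic_maps_stereo])

lemma F_subset_D: "F d i \<subseteq> topspace (D d)"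
  by (auto simp: F_def F'_def topspace_D)

text \<open>The denominator \<open>S + 1\<close> is positive, so the coordinate vanishes exactly
  when the gap \<open>t (Suc i) - t i\<close> does. Infinity lies in every face, and
  \<open>pole\<close> on every wall.\<close>

lemma in_F_iff:
  assumes "z \<in> topspace (D d)" "Suc i < d"
  shows "z \<in> F d i \<longleftrightarrow> to_sphere d z (Suc (Suc i)) = 0"
proof (cases z)
  case None
  then show ?thesis by (simp add: F_def to_sphere_def pole_def)
next
  case (Some t)
  have "(\<Sum>j=1..d. gap t j ^ 2) + 1 \<noteq> 0"
    using sum_nonneg[of "{1..d}" "\<lambda>j. gap t j ^ 2"] by (simp add: add_nonneg_eq_0_iff)
  then have "stereo d t (Suc (Suc i)) = 0 \<longleftrightarrow> gap t (Suc (Suc i)) = 0"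
    using assms(2) by (simp add: stereo_def Let_def)
  also have "\<dots> \<longleftrightarrow> t i = t (Suc i)"
    by (auto simp: gap_def)
  finally show ?thesis
    using assms Some by (auto simp: F_def F'_def to_sphere_def topspace_D)
qed

text \<open>Coordinates 2 to \<open>d\<close> are matched with the faces by \<open>in_F_iff\<close>,
  and those above \<open>d\<close> vanish on the orthant.\<close>

lemma in_faces_inter_iff:
  assumes "d \<ge> 1" "z \<in> topspace (D d)"
  shows "z \<in> faces_inter d \<longleftrightarrow> to_sphere d z \<in> topspace (nsphere 1)"
proof -
  have Q: "to_sphere d z \<in> topspace (orthant_sphere d)"
    using homeomorphic_imp_surjective_map[OF homeomorphic_map_to_sphere] assms(2) by blast
  have "z \<in> faces_inter d \<longleftrightarrow> (\<forall>i. Suc i < d \<longrightarrow> to_sphere d z (Suc (Suc i)) = 0)"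
    using assms(2) in_F_iff[OF assms(2)] by (auto simp: faces_inter_def)
  also have "\<dots> \<longleftrightarrow> (\<forall>i\<ge>2. to_sphere d z i = 0)"
  proof
    assume *: "\<forall>i. Suc i < d \<longrightarrow> to_sphere d z (Suc (Suc i)) = 0"
    show "\<forall>i\<ge>2. to_sphere d z i = 0"
    proof (intro allI impI)
      fix i :: nat assume "2 \<le> i"
      then obtain j where "i = Suc (Suc j)"
        by (metis One_nat_def Suc_1 Suc_le_D le_Suc_eq)
      then show "to_sphere d z i = 0"
        using * Q unfolding in_orthant_sphere by (cases "i \<le> d") auto
    qed
  qed auto
  finally show ?thesis
    using in_nsphere1_orthant_sphere[OF assms(1)] Q by blast
qed

lemma faces_inter_eq: "faces_inter d = insert None (range (\<lambda>t. Some (diag d t)))"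
proof
  show "faces_inter d \<subseteq> insert None (range (\<lambda>t. Some (diag d t)))"
  proof
    fix z assume z: "z \<in> faces_inter d"
    show "z \<in> insert None (range (\<lambda>t. Some (diag d t)))"
    proof (cases z)
      case (Some t)
      then have t: "t \<in> topspace (D' d)" "\<And>i. Suc i < d \<Longrightarrow> t i = t (Suc i)"
        using z by (auto simp: faces_inter_def topspace_D F_def F'_def)
      have const: "i < d \<Longrightarrow> t i = t 0" for i
        by (induction i) (use t(2) in auto)
      have "t = diag d (t 0)"
      proof
        fix i show "t i = diag d (t 0) i"
          using const[of i] t(1) unfolding diag_def in_D' by simp
      qed
      then show ?thesis
        using Some by blast
    qed simp
  qed
  show "insert None (range (\<lambda>t. Some (diag d t))) \<subseteq> faces_inter d"
    by (auto simp: faces_inter_def topspace_D F_def F'_def in_D' diag_def)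
qed

section \<open>Restriction to the circle in which the faces meet\<close>

lemma preserves_faces_faces_inter:
  assumes "continuous_map (D d) (D d) f" "preserves_faces d f" "z \<in> faces_inter d"
  shows "f z \<in> faces_inter d"
proof -
  \<comment> \<open>This is the whole condition when \<open>d = 1\<close>, where there are no
    faces.\<close>
  have "f z \<in> topspace (D d)"
    using assms(1,3) continuous_map_image_subset_topspace by (fastforce simp: faces_inter_def)
  then show ?thesis
    using assms(2,3) unfolding faces_inter_def preserves_faces_def by blast
qed

lemma continuous_map_faces_inter:
  assumes "continuous_map (D d) (D d) f" "preserves_faces d f"
  defines "C \<equiv> subtopology (D d) (faces_inter d)"
  shows "continuous_map C C f"
  unfolding C_def continuous_map_in_subtopology
  using assms preserves_faces_faces_inter by (auto intro: continuous_map_from_subtopology)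

text \<open>Every stage preserves all faces, hence their intersection, so the homotopy restricts to
  the circle.\<close>

lemma homotopic_with_faces_inter:
  assumes "homotopic_with (preserves_faces d) (D d) (D d) f g"
  defines "C \<equiv> subtopology (D d) (faces_inter d)"
  shows "homotopic_with (\<lambda>_. True) C C f g"
proof -
  let ?I = "top_of_set {0..1::real}"
  obtain h where h: "continuous_map (prod_topology ?I (D d)) (D d) h"
      "\<And>z. h (0, z) = f z" "\<And>z. h (1, z) = g z"
    and pres: "\<And>s. s \<in> {0..1} \<Longrightarrow> preserves_faces d (\<lambda>z. h (s, z))"
    using assms(1) unfolding homotopic_with_def by blast
  have "h (s, z) \<in> faces_inter d" if "s \<in> {0..1}" "z \<in> faces_inter d" for s z
  proof (rule preserves_faces_faces_inter[OF _ pres[OF that(1)] that(2)])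
    show "continuous_map (D d) (D d) (\<lambda>z. h (s, z))"
      using continuous_map_o_Pair[OF h(1), of s] that(1) by (simp add: o_def)
  qed
  moreover have "continuous_map (prod_topology ?I C) (D d) h"
    unfolding C_def prod_topology_subtopology(2) by (rule continuous_map_from_subtopology[OF h(1)])
  ultimately have "continuous_map (prod_topology ?I C) C h"
    unfolding C_def continuous_map_in_subtopology by auto
  then show ?thesis
    unfolding homotopic_with_def using h by blast
qed

section \<open>Conjugation to the orthant and the two implications\<close>

theorem theorem4:
  fixes d :: nat
    and f g :: "(nat \<Rightarrow> real) option \<Rightarrow> (nat \<Rightarrow> real) option"
  assumes "d \<ge> 1"
    and "continuous_map (D d) (D d) f"
    and "continuous_map (D d) (D d) g"
    and "preserves_faces d f"
    and "preserves_faces d g"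
  defines "C \<equiv> subtopology (D d) (faces_inter d)"
  shows "faces_inter d = insert None (range (\<lambda>t. Some (diag d t)))
    \<and> C homeomorphic_space nsphere 1
    \<and> continuous_map C C f
    \<and> continuous_map C C g
    \<and> (\<forall>\<phi> \<psi>. homeomorphic_maps C (nsphere 1) \<phi> \<psi> \<longrightarrow>
          (homotopic_with (preserves_faces d) (D d) (D d) f g
            \<longleftrightarrow> circle_degree \<phi> \<psi> f = circle_degree \<phi> \<psi> g))"
proof -
  let ?Q = "orthant_sphere d"
  let ?S = "nsphere 1"
  let ?\<Phi> = "to_sphere d"
  obtain \<Psi> where hom: "homeomorphic_maps (D d) ?Q ?\<Phi> \<Psi>"
    using homeomorphic_map_to_sphere homeomorphic_map_maps by blast
  then have cont\<Phi>: "continuous_map (D d) ?Q ?\<Phi>" and cont\<Psi>: "continuous_map ?Q (D d) \<Psi>"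
    and \<Psi>\<Phi>: "\<And>z. z \<in> topspace (D d) \<Longrightarrow> \<Psi> (?\<Phi> z) = z"
    and \<Phi>\<Psi>: "\<And>v. v \<in> topspace ?Q \<Longrightarrow> ?\<Phi> (\<Psi> v) = v"
    by (auto simp: homeomorphic_maps_def)
  have \<Phi>_in: "?\<Phi> z \<in> topspace ?Q" if "z \<in> topspace (D d)" for z
    using cont\<Phi> that continuous_map_image_subset_topspace by blast
  have \<Psi>_in: "\<Psi> v \<in> topspace (D d)" if "v \<in> topspace ?Q" for v
    using cont\<Psi> that continuous_map_image_subset_topspace by blast
  have S_in: "v \<in> topspace ?Q" if "v \<in> topspace ?S" for v
    using in_nsphere1_orthant_sphere[OF \<open>d \<ge> 1\<close>] that by blast
  have "?\<Phi> ` (topspace (D d) \<inter> faces_inter d) \<subseteq> topspace ?S"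
    using in_faces_inter_iff[OF \<open>d \<ge> 1\<close>] by auto
  moreover have "\<Psi> ` (topspace ?Q \<inter> topspace ?S) \<subseteq> faces_inter d"
    using in_faces_inter_iff[OF \<open>d \<ge> 1\<close> \<Psi>_in] \<Phi>\<Psi> by auto
  ultimately have "homeomorphic_maps C (subtopology ?Q (topspace ?S)) ?\<Phi> \<Psi>"
    unfolding C_def by (rule homeomorphic_maps_subtopologies_alt[OF hom])
  \<comment> \<open>This is one identification of \<open>C\<close> with the circle; an arbitrary
    pair \<open>\<phi>\<close>, \<open>\<psi>\<close> is compared with it below.\<close>
  then have homC: "homeomorphic_maps C ?S ?\<Phi> \<Psi>"
    by (simp only: subtopology_orthant_sphere_nsphere1[OF \<open>d \<ge> 1\<close>])
  then have cont\<Phi>C: "continuous_map C ?S ?\<Phi>" and cont\<Psi>C: "continuous_map ?S C \<Psi>"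
    by (auto simp: homeomorphic_maps_def)
  have contC: "continuous_map C C k"
    if "continuous_map (D d) (D d) k" "preserves_faces d k" for k
    unfolding C_def using continuous_map_faces_inter that by blast

  \<comment> \<open>Conjugation by \<open>?\<Phi>\<close> turns face-preserving maps into
    wall-keeping ones: face \<open>j\<close> becomes the wall with index
    \<open>j + 2\<close>.\<close>
  have walls: "continuous_map ?Q ?Q (?\<Phi> \<circ> k \<circ> \<Psi>) \<and> keeps_walls d (?\<Phi> \<circ> k \<circ> \<Psi>)"
    if k: "continuous_map (D d) (D d) k" "preserves_faces d k" for k
  proof
    show cont: "continuous_map ?Q ?Q (?\<Phi> \<circ> k \<circ> \<Psi>)"
      by (intro continuous_map_compose[OF cont\<Psi>] continuous_map_compose[OF k(1)] cont\<Phi>)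
    show "keeps_walls d (?\<Phi> \<circ> k \<circ> \<Psi>)"
      unfolding keeps_walls_def
    proof (intro allI ballI impI)
      fix i v assume i: "2 \<le> i" and v: "v \<in> topspace ?Q" and "v i = 0"
      obtain j where j: "i = Suc (Suc j)"
        using i by (metis One_nat_def Suc_1 Suc_le_D le_Suc_eq)
      have out: "(?\<Phi> \<circ> k \<circ> \<Psi>) v \<in> topspace ?Q"
        using cont v unfolding continuous_map_into_orthant_sphere by blast
      show "(?\<Phi> \<circ> k \<circ> \<Psi>) v i = 0"
      proof (cases "i \<le> d")
        case True
        then have "Suc j < d"
          using j by simp
        then have "\<Psi> v \<in> F d j"
          using \<open>v i = 0\<close> in_F_iff[OF \<Psi>_in[OF v]] \<Phi>\<Psi>[OF v] j by simp
        then have "k (\<Psi> v) \<in> F d j"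
          using k(2) \<open>Suc j < d\<close> unfolding preserves_faces_def by blast
        then show ?thesis
          using in_F_iff[of "k (\<Psi> v)" d j] F_subset_D \<open>Suc j < d\<close> j by auto
      qed (use out in \<open>simp add: in_orthant_sphere\<close>)
    qed
  qed
  \<comment> \<open>The reverse conjugation, applied below to each stage of a homotopy on the
    orthant.\<close>
  have faces: "preserves_faces d (\<Psi> \<circ> k \<circ> ?\<Phi>)"
    if k: "continuous_map ?Q ?Q k" "keeps_walls d k" for k
    unfolding preserves_faces_def
  proof (intro allI impI subsetI)
    fix i z assume i: "Suc i < d" and "z \<in> (\<Psi> \<circ> k \<circ> ?\<Phi>) ` F d i"
    then obtain y where y: "y \<in> F d i" "z = \<Psi> (k (?\<Phi> y))"
      by auto
    then have yD: "y \<in> topspace (D d)"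
      using F_subset_D by blast
    have kin: "k (?\<Phi> y) \<in> topspace ?Q"
      using k(1) \<Phi>_in[OF yD] unfolding continuous_map_into_orthant_sphere by blast
    have "?\<Phi> y (Suc (Suc i)) = 0"
      using in_F_iff[OF yD i] y(1) by simp
    then have "k (?\<Phi> y) (Suc (Suc i)) = 0"
      using k(2) \<Phi>_in[OF yD] by (simp add: keeps_walls_def)
    then show "z \<in> F d i"
      using in_F_iff[OF \<Psi>_in[OF kin] i] \<Phi>\<Psi>[OF kin] y(2) by simp
  qed

  have "homotopic_with (preserves_faces d) (D d) (D d) f g"
    if \<phi>\<psi>: "homeomorphic_maps C ?S \<phi> \<psi>" and deg: "circle_degree \<phi> \<psi> f = circle_degree \<phi> \<psi> g" for \<phi> \<psi>
  proof -
    have cont\<phi>: "continuous_map C ?S \<phi>" and cont\<psi>: "continuous_map ?S C \<psi>"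
      and \<psi>\<phi>: "\<And>z. z \<in> topspace C \<Longrightarrow> \<psi> (\<phi> z) = z"
      using \<phi>\<psi> by (auto simp: homeomorphic_maps_def)
    \<comment> \<open>Insert \<open>\<psi> \<circ> \<phi>\<close> on both sides of \<open>k\<close>
      and use multiplicativity of the degree. The outer factors do not depend on \<open>k\<close>,
      so equality of degrees passes from \<open>\<phi>\<close>, \<open>\<psi>\<close> to
      \<open>?\<Phi>\<close>, \<open>\<Psi>\<close>.\<close>
    have degree: "Brouwer_degree2 1 (?\<Phi> \<circ> k \<circ> \<Psi>) =
        Brouwer_degree2 1 (?\<Phi> \<circ> \<psi>) * circle_degree \<phi> \<psi> k * Brouwer_degree2 1 (\<phi> \<circ> \<Psi>)"
      if k: "continuous_map C C k" for k
    proof -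
      have c: "continuous_map ?S ?S (?\<Phi> \<circ> \<psi>)" "continuous_map ?S ?S (\<phi> \<circ> k \<circ> \<psi>)" "continuous_map ?S ?S (\<phi> \<circ> \<Psi>)"
        using continuous_map_compose[OF cont\<psi> cont\<Phi>C] continuous_map_compose[OF cont\<Psi>C cont\<phi>]
          continuous_map_compose[OF cont\<psi> continuous_map_compose[OF k cont\<phi>]] by simp_all
      have "Brouwer_degree2 1 (?\<Phi> \<circ> k \<circ> \<Psi>) =
          Brouwer_degree2 1 (((?\<Phi> \<circ> \<psi>) \<circ> (\<phi> \<circ> k \<circ> \<psi>)) \<circ> (\<phi> \<circ> \<Psi>))"
      proof (rule Brouwer_degree2_eq)
        fix v assume v: "v \<in> topspace ?S"
        have "\<Psi> v \<in> topspace C"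
          using cont\<Psi>C v continuous_map_image_subset_topspace by blast
        moreover from this have "k (\<Psi> v) \<in> topspace C"
          using k continuous_map_image_subset_topspace by blast
        ultimately show "(?\<Phi> \<circ> k \<circ> \<Psi>) v = (((?\<Phi> \<circ> \<psi>) \<circ> (\<phi> \<circ> k \<circ> \<psi>)) \<circ> (\<phi> \<circ> \<Psi>)) v"
          using \<psi>\<phi> by simp
      qed
      also have "\<dots> = Brouwer_degree2 1 (?\<Phi> \<circ> \<psi>) * circle_degree \<phi> \<psi> k * Brouwer_degree2 1 (\<phi> \<circ> \<Psi>)"
        unfolding circle_degree_def
        using Brouwer_degree2_compose[OF c(3) continuous_map_compose[OF c(2) c(1)]]
          Brouwer_degree2_compose[OF c(2) c(1)] by simp
      finally show ?thesis .
    qed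
    have circ: "continuous_map ?S ?S (?\<Phi> \<circ> k \<circ> \<Psi>)" if "continuous_map C C k" for k
      by (intro continuous_map_compose[OF cont\<Psi>C] continuous_map_compose[OF that] cont\<Phi>C)
    have fC: "continuous_map C C f" and gC: "continuous_map C C g"
      using contC assms by blast+
    have "Brouwer_degree2 1 (?\<Phi> \<circ> f \<circ> \<Psi>) = Brouwer_degree2 1 (?\<Phi> \<circ> g \<circ> \<Psi>)"
      using degree[OF fC] degree[OF gC] deg by simp
    then obtain h where h: "continuous_map ?S euclideanreal h"
        "\<And>x. x \<in> topspace ?S \<Longrightarrow> (?\<Phi> \<circ> f \<circ> \<Psi>) x = rot (h x) ((?\<Phi> \<circ> g \<circ> \<Psi>) x)"
      using same_degree_imp_rotation[OF circ[OF fC] circ[OF gC]] by blast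
    have "homotopic_with (keeps_walls d) ?Q ?Q (?\<Phi> \<circ> f \<circ> \<Psi>) (?\<Phi> \<circ> g \<circ> \<Psi>)"
      using homotopic_rotated_on_circle[OF \<open>d \<ge> 1\<close> _ _ _ _ h] walls assms(2-5) by blast
    \<comment> \<open>Continuity of each stage is recorded because \<open>faces\<close> asks for
      it.\<close>
    then have "homotopic_with (\<lambda>k. continuous_map ?Q ?Q k \<and> keeps_walls d k) ?Q ?Q
        (?\<Phi> \<circ> f \<circ> \<Psi>) (?\<Phi> \<circ> g \<circ> \<Psi>)"
      by (rule homotopic_with_mono) blast
    then have "homotopic_with (\<lambda>k. preserves_faces d (k \<circ> ?\<Phi>)) ?Q (D d)
        (\<Psi> \<circ> (?\<Phi> \<circ> f \<circ> \<Psi>)) (\<Psi> \<circ> (?\<Phi> \<circ> g \<circ> \<Psi>))"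
      by (rule homotopic_with_compose_continuous_map_left[OF _ cont\<Psi>]) (use faces in blast)
    then have *: "homotopic_with (preserves_faces d) (D d) (D d)
        (\<Psi> \<circ> (?\<Phi> \<circ> f \<circ> \<Psi>) \<circ> ?\<Phi>) (\<Psi> \<circ> (?\<Phi> \<circ> g \<circ> \<Psi>) \<circ> ?\<Phi>)"
      by (rule homotopic_with_compose_continuous_map_right[OF _ cont\<Phi>]) blast
    \<comment> \<open>\<open>\<Psi> \<circ> ?\<Phi>\<close> is the identity only on the space, so
      \<open>k\<close> and its double conjugate may differ outside it; they are joined by a constant
      homotopy.\<close>
    have same: "homotopic_with (preserves_faces d) (D d) (D d) k (\<Psi> \<circ> (?\<Phi> \<circ> k \<circ> \<Psi>) \<circ> ?\<Phi>)"
      if k: "continuous_map (D d) (D d) k" "preserves_faces d k" for k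
    proof (rule homotopic_with_equal)
      show "preserves_faces d (\<Psi> \<circ> (?\<Phi> \<circ> k \<circ> \<Psi>) \<circ> ?\<Phi>)"
        using faces walls[OF k] by blast
      show "preserves_faces d k" "continuous_map (D d) (D d) k"
        by (fact k)+
      fix z assume "z \<in> topspace (D d)"
      moreover from this have "k z \<in> topspace (D d)"
        using k(1) continuous_map_image_subset_topspace by blast
      ultimately show "k z = (\<Psi> \<circ> (?\<Phi> \<circ> k \<circ> \<Psi>) \<circ> ?\<Phi>) z"
        using \<Psi>\<Phi> by simp
    qed
    show ?thesis
      using homotopic_with_trans[OF homotopic_with_trans[OF same *] homotopic_with_symD[OF same]] assms(2-5)
      by blast
  qed
  moreover have "circle_degree \<phi> \<psi> f = circle_degree \<phi> \<psi> g"
    if \<phi>\<psi>: "homeomorphic_maps C ?S \<phi> \<psi>" and fg: "homotopic_with (preserves_faces d) (D d) (D d) f g" for \<phi> \<psi>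
  proof -
    have cont\<phi>: "continuous_map C ?S \<phi>" and cont\<psi>: "continuous_map ?S C \<psi>"
      using \<phi>\<psi> by (auto simp: homeomorphic_maps_def)
    \<comment> \<open>Restrict the homotopy to \<open>C\<close>, conjugate it to the circle, and use
      homotopy invariance of the degree.\<close>
    have "homotopic_with (\<lambda>_. True) C C f g"
      unfolding C_def by (rule homotopic_with_faces_inter[OF fg])
    then have "homotopic_with (\<lambda>_. True) C ?S (\<phi> \<circ> f) (\<phi> \<circ> g)"
      by (rule homotopic_with_compose_continuous_map_left[OF _ cont\<phi>]) simp
    then have "homotopic_with (\<lambda>_. True) ?S ?S (\<phi> \<circ> f \<circ> \<psi>) (\<phi> \<circ> g \<circ> \<psi>)"
      by (rule homotopic_with_compose_continuous_map_right[OF _ cont\<psi>]) simp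
    then show ?thesis
      unfolding circle_degree_def by (rule Brouwer_degree2_homotopic)
  qed
  ultimately have "\<forall>\<phi> \<psi>. homeomorphic_maps C ?S \<phi> \<psi> \<longrightarrow>
      (homotopic_with (preserves_faces d) (D d) (D d) f g
        \<longleftrightarrow> circle_degree \<phi> \<psi> f = circle_degree \<phi> \<psi> g)"
    by (intro allI impI iffI)
  moreover have "C homeomorphic_space ?S"
    using homC by (rule homeomorphic_maps_imp_homeomorphic_space)
  moreover have "continuous_map C C f" "continuous_map C C g"
    by (intro contC assms)+
  ultimately show ?thesis
    using faces_inter_eq by (intro conjI)
qed

end
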